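(* Let $\mathscr T=(V,E)$ be a rooted directed tree with root $\mathsf{root}$. For $u,b\in V$, consider a weight system $\lambda_u=\{\lambda_{uv}\}$ of complex numbers and let $W_{f,g}$ be the rank one extension of the weighted join operator $W^{(b)}_{\lambda_u}$ on $\mathscr T$, where $f\in\ell^2(V)\ominus\mathscr H$ is non-zero and $g:U\to\mathbb C$ is given ($U$, $\mathscr H=\ell^2(U)$, $W_{f,g}$ and compatibility condition II are defined in the context). Suppose that $W_{f,g}$ satisfies the compatibility condition II. If $\{\lambda_{uv}:v\in U\}$ is contained in the sector $\mathbb S_{\theta,\alpha}:=\{z\in\mathbb C:|\arg(z-\alpha)|<\theta\}$ for some $\theta\in(0,\pi/2)$ and $\alpha\in\mathbb R$, then $W_{f,g}$ is a sectorial operator.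
   Context: Trees. A directed tree $\mathscr T=(V,E)$ is a directed graph (no loops, $V$ and $E$ nonempty) which has no circuits, is connected (ignoring orientation), and in which every non-root vertex $v$ has exactly one parent $\mathsf{par}(v)$; it is rooted if there is a unique vertex $\mathsf{root}$ without parent. Throughout $\mathrm{card}(V)=\aleph_0$. $\mathsf{Des}(u)$ is the set of descendants of $u$, including $u$; $\mathsf{Asc}(u)=\{\mathsf{par}^{\langle n\rangle}(u):n\ge1\}$; for $v\in\mathsf{Des}(u)$, $[u,v]$ is the set of vertices of the directed path from $u$ to $v$ and $\mathsf{Des}_v(u)=\mathsf{Des}(u)\setminus[u,v]$. Rank one extension. Let $u,b\in V$ and $\{\lambda_{uv}\}_{v\in V}\subseteq\mathbb C$. Put $U=V\setminus\{u\}$ if $b=u$; $U=\mathsf{Asc}(u)\cup\mathsf{Des}_b(u)$ if $b\in\mathsf{Des}(u)\setminus\{u\}$; $U=\mathsf{Des}(u)\setminus\{u\}$ if $b\notin\mathsf{Des}(u)$. Put $A_u=[u,b]$ if $b\in\mathsf{Des}(u)$ and $A_u=\mathsf{Asc}(u)\cup\{b,u\}$ otherwise. $\mathscr H=\mathscr H^{(b)}_u=\ell^2(U)\subseteq\ell^2(V)$. $D=D^{(b)}_{\lambda_u}$ is the maximally defined diagonal operator in $\mathscr H$ with $De_v=\lambda_{uv}e_v$ ($v\in U$), and $N=N^{(b)}_{\lambda_u}=e_u\otimes e_{\lambda_u,A_u}$ on $\ell^2(V)\ominus\mathscr H$, with $e_{\lambda_u,A_u}=\sum_{v\in A_u}\overline{\lambda_{uv}}e_v$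 and $(x\otimes y)h=\langle h,y\rangle x$. (The weighted join operator is $W^{(b)}_{\lambda_u}=D\oplus N$.) The operator $f\oslash g$ has domain $\{h\in\mathscr H:\sum_{v\in U}h(v)\overline{g(v)}\text{ is convergent}\}$ and $(f\oslash g)h=\big(\sum_{v\in U}h(v)\overline{g(v)}\big)f$. $W_{f,g}$ is the operator in $\ell^2(V)$ with domain $\{(h,k):h\in\mathscr D(D)\cap\mathscr D(f\oslash g),\ k\in\ell^2(V)\ominus\mathscr H\}$ and $W_{f,g}=\begin{bmatrix}D&0\\ f\oslash g&N\end{bmatrix}$. Compatibility condition II: $\sum_{v\in U}\frac{|g(v)|^2}{|\lambda_{uv}|^2+1}<\infty$. A densely defined operator $T$ is sectorial if there exist $a\in\mathbb R$, $M\in(0,\infty)$ and $\theta\in(0,\pi/2)$ such that $\lambda\in\rho(T)$ and $\|(T-\lambda)^{-1}\|\le\frac{M}{|\lambda-a|}$ whenever $\lambda\in\mathbb C$ and $|\arg(\lambda-a)|\ge\theta$. *)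

theory Defs
  imports "HOL-Analysis.Analysis"
begin

section \<open>Directed trees\<close>

definition tree_root :: "'v set \<Rightarrow> ('v \<times> 'v) set \<Rightarrow> 'v \<Rightarrow> bool" where
  "tree_root V E r \<longleftrightarrow> r \<in> V \<and> (\<nexists>w. (w, r) \<in> E)"

text \<open>An edge \<open>(w, v)\<close> points from the parent \<open>w\<close> to the child \<open>v\<close>.  Acyclicity excludes
  loops as well as longer circuits.\<close>

definition directed_tree :: "'v set \<Rightarrow> ('v \<times> 'v) set \<Rightarrow> bool" where
  "directed_tree V E \<longleftrightarrow>
     V \<noteq> {} \<and> E \<noteq> {} \<and> E \<subseteq> V \<times> V \<and> acyclic E \<and>
     (\<forall>u\<in>V. \<forall>v\<in>V. (u, v) \<in> (E \<union> E\<inverse>)\<^sup>*) \<and>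
     (\<forall>v\<in>V. \<not> tree_root V E v \<longrightarrow> (\<exists>!w. (w, v) \<in> E))"

definition rooted_directed_tree :: "'v set \<Rightarrow> ('v \<times> 'v) set \<Rightarrow> bool" where
  "rooted_directed_tree V E \<longleftrightarrow> directed_tree V E \<and> (\<exists>!r. tree_root V E r)"

definition Des :: "('v \<times> 'v) set \<Rightarrow> 'v \<Rightarrow> 'v set" where
  "Des E u = {v. (u, v) \<in> E\<^sup>*}"

text \<open>Since parents are unique, \<open>(w, u) \<in> E ^^ n\<close> says that the \<open>n\<close>-th iterate of the
  partial parent map is defined at \<open>u\<close> with value \<open>w\<close>.\<close>

definition Asc :: "('v \<times> 'v) set \<Rightarrow> 'v \<Rightarrow> 'v set" where
  "Asc E u = {w. \<exists>n\<ge>1. (w, u) \<in> E ^^ n}"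

text \<open>In a directed tree there is at most one directed path from \<open>u\<close> to \<open>v\<close>; the
  following are its vertices.\<close>

definition tree_path :: "('v \<times> 'v) set \<Rightarrow> 'v \<Rightarrow> 'v \<Rightarrow> 'v set" where
  "tree_path E u v = {w. (u, w) \<in> E\<^sup>* \<and> (w, v) \<in> E\<^sup>*}"


section \<open>The spaces \<open>\<ell>\<^sup>2(V)\<close>\<close>

text \<open>Elements of \<open>\<ell>\<^sup>2(V)\<close> are functions on the whole vertex type that vanish off \<open>V\<close>, so
  that \<open>\<ell>\<^sup>2(U) \<subseteq> \<ell>\<^sup>2(V)\<close> holds literally whenever \<open>U \<subseteq> V\<close>.\<close>

definition ell2 :: "'v set \<Rightarrow> ('v \<Rightarrow> complex) set" where
  "ell2 V = {h. (\<forall>v. v \<notin> V \<longrightarrow> h v = 0) \<and> (\<lambda>v. (cmod (h v))\<^sup>2) summable_on V}"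

definition ell2_inner :: "'v set \<Rightarrow> ('v \<Rightarrow> complex) \<Rightarrow> ('v \<Rightarrow> complex) \<Rightarrow> complex" where
  "ell2_inner V h k = (\<Sum>\<^sub>\<infinity>v\<in>V. h v * cnj (k v))"

definition ell2_norm :: "'v set \<Rightarrow> ('v \<Rightarrow> complex) \<Rightarrow> real" where
  "ell2_norm V h = sqrt (\<Sum>\<^sub>\<infinity>v\<in>V. (cmod (h v))\<^sup>2)"

definition ell2_compl :: "'v set \<Rightarrow> ('v \<Rightarrow> complex) set \<Rightarrow> ('v \<Rightarrow> complex) set" where
  "ell2_compl V H = {k \<in> ell2 V. \<forall>h\<in>H. ell2_inner V h k = 0}"

text \<open>For \<open>U \<subseteq> V\<close> this is the orthogonal projection of \<open>\<ell>\<^sup>2(V)\<close> onto \<open>\<ell>\<^sup>2(U)\<close>.\<close>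

definition ell2_proj :: "'v set \<Rightarrow> ('v \<Rightarrow> complex) \<Rightarrow> 'v \<Rightarrow> complex" where
  "ell2_proj U h = (\<lambda>v. if v \<in> U then h v else 0)"


section \<open>Unbounded operators in \<open>\<ell>\<^sup>2(V)\<close>\<close>

text \<open>The values of \<open>op_app T\<close> outside \<open>op_dom T\<close> are irrelevant.\<close>

record 'v op =
  op_dom :: "('v \<Rightarrow> complex) set"
  op_app :: "('v \<Rightarrow> complex) \<Rightarrow> 'v \<Rightarrow> complex"

definition linear_op :: "'v set \<Rightarrow> 'v op \<Rightarrow> bool" where
  "linear_op V T \<longleftrightarrow>
     op_dom T \<subseteq> ell2 V \<and> op_app T ` op_dom T \<subseteq> ell2 V \<and> (\<lambda>_. 0) \<in> op_dom T \<and>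
     (\<forall>x\<in>op_dom T. \<forall>y\<in>op_dom T. (\<lambda>v. x v + y v) \<in> op_dom T \<and>
        op_app T (\<lambda>v. x v + y v) = (\<lambda>v. op_app T x v + op_app T y v)) \<and>
     (\<forall>c. \<forall>x\<in>op_dom T. (\<lambda>v. c * x v) \<in> op_dom T \<and>
        op_app T (\<lambda>v. c * x v) = (\<lambda>v. c * op_app T x v))"

definition densely_defined :: "'v set \<Rightarrow> 'v op \<Rightarrow> bool" where
  "densely_defined V T \<longleftrightarrow>
     (\<forall>x\<in>ell2 V. \<forall>\<epsilon>>0. \<exists>y\<in>op_dom T. ell2_norm V (\<lambda>v. x v - y v) < \<epsilon>)"

definition op_shift :: "'v op \<Rightarrow> complex \<Rightarrow> 'v op" where
  "op_shift T z = \<lparr>op_dom = op_dom T, op_app = (\<lambda>x v. op_app T x v - z * x v)\<rparr>"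

definition resolvent :: "'v op \<Rightarrow> complex \<Rightarrow> ('v \<Rightarrow> complex) \<Rightarrow> 'v \<Rightarrow> complex" where
  "resolvent T z = inv_into (op_dom (op_shift T z)) (op_app (op_shift T z))"

definition ell2_bounded :: "'v set \<Rightarrow> (('v \<Rightarrow> complex) \<Rightarrow> 'v \<Rightarrow> complex) \<Rightarrow> bool" where
  "ell2_bounded V S \<longleftrightarrow> (\<exists>C. \<forall>x\<in>ell2 V. ell2_norm V (S x) \<le> C * ell2_norm V x)"

text \<open>As a supremum of reals, this is meaningful only for bounded \<open>S\<close>; below it is applied
  to resolvents at points of the resolvent set only.\<close>

definition ell2_opnorm :: "'v set \<Rightarrow> (('v \<Rightarrow> complex) \<Rightarrow> 'v \<Rightarrow> complex) \<Rightarrow> real" where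
  "ell2_opnorm V S = (SUP x\<in>{x \<in> ell2 V. ell2_norm V x \<le> 1}. ell2_norm V (S x))"

definition resolvent_set :: "'v set \<Rightarrow> 'v op \<Rightarrow> complex set" where
  "resolvent_set V T =
     {z. bij_betw (op_app (op_shift T z)) (op_dom (op_shift T z)) (ell2 V) \<and>
         ell2_bounded V (resolvent T z)}"

text \<open>Here and in the sector below, \<open>Arg\<close> is the principal argument, with values in
  \<open>(-\<pi>, \<pi>]\<close>, and \<open>Arg 0 = 0\<close>.  Hence \<open>z = a\<close> is exempt from the resolvent estimate
  (which would involve division by zero), and the vertex \<open>\<alpha>\<close> belongs to \<open>sector \<theta> \<alpha>\<close>.\<close>

definition sectorial :: "'v set \<Rightarrow> 'v op \<Rightarrow> bool" where
  "sectorial V T \<longleftrightarrow> linear_op V T \<and> densely_defined V T \<and>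
     (\<exists>a M \<theta> :: real. 0 < M \<and> 0 < \<theta> \<and> \<theta> < pi / 2 \<and>
        (\<forall>z. \<bar>Arg (z - of_real a)\<bar> \<ge> \<theta> \<longrightarrow>
           z \<in> resolvent_set V T \<and>
           ell2_opnorm V (resolvent T z) \<le> M / cmod (z - of_real a)))"

definition sector :: "real \<Rightarrow> real \<Rightarrow> complex set" where
  "sector \<theta> \<alpha> = {z. \<bar>Arg (z - of_real \<alpha>)\<bar> < \<theta>}"


section \<open>Rank one extensions of weighted join operators\<close>

definition join_U :: "'v set \<Rightarrow> ('v \<times> 'v) set \<Rightarrow> 'v \<Rightarrow> 'v \<Rightarrow> 'v set" where
  "join_U V E u b =
     (if b = u then V - {u}
      else if b \<in> Des E u then Asc E u \<union> (Des E u - tree_path E u b)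
      else Des E u - {u})"

definition join_A :: "('v \<times> 'v) set \<Rightarrow> 'v \<Rightarrow> 'v \<Rightarrow> 'v set" where
  "join_A E u b = (if b \<in> Des E u then tree_path E u b else Asc E u \<union> {b, u})"

definition diag_op :: "'v set \<Rightarrow> ('v \<Rightarrow> complex) \<Rightarrow> 'v op" where
  "diag_op U lam =
     \<lparr>op_dom = {h \<in> ell2 U. (\<lambda>v. lam v * h v) \<in> ell2 U}, op_app = (\<lambda>h v. lam v * h v)\<rparr>"

definition unit_vec :: "'v \<Rightarrow> 'v \<Rightarrow> complex" where
  "unit_vec w = (\<lambda>v. if v = w then 1 else 0)"

text \<open>The vector \<open>\<Sum>\<^sub>v\<^sub>\<in>\<^sub>A cnj (lam v) e\<^sub>v\<close>; for \<open>A = join_A E u b\<close> in a rooted tree, \<open>A\<close> is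
  finite.\<close>

definition weight_vec :: "('v \<Rightarrow> complex) \<Rightarrow> 'v set \<Rightarrow> 'v \<Rightarrow> complex" where
  "weight_vec lam A = (\<lambda>w. \<Sum>v\<in>A. cnj (lam v) * unit_vec v w)"

definition tensor_op ::
  "'v set \<Rightarrow> ('v \<Rightarrow> complex) set \<Rightarrow> ('v \<Rightarrow> complex) \<Rightarrow> ('v \<Rightarrow> complex) \<Rightarrow> 'v op" where
  "tensor_op V K x y = \<lparr>op_dom = K, op_app = (\<lambda>h v. ell2_inner V h y * x v)\<rparr>"

text \<open>The operator \<open>f \<oslash> g\<close>; here \<open>g\<close> need not be square-summable.\<close>

definition oslash_op :: "'v set \<Rightarrow> ('v \<Rightarrow> complex) \<Rightarrow> ('v \<Rightarrow> complex) \<Rightarrow> 'v op" where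
  "oslash_op U f g =
     \<lparr>op_dom = {h \<in> ell2 U. (\<lambda>v. h v * cnj (g v)) summable_on U},
      op_app = (\<lambda>h w. (\<Sum>\<^sub>\<infinity>v\<in>U. h v * cnj (g v)) * f w)\<rparr>"

definition join_N ::
  "'v set \<Rightarrow> ('v \<times> 'v) set \<Rightarrow> 'v \<Rightarrow> 'v \<Rightarrow> ('v \<Rightarrow> complex) \<Rightarrow> 'v op" where
  "join_N V E u b lam =
     tensor_op V (ell2_compl V (ell2 (join_U V E u b)))
       (unit_vec u) (weight_vec lam (join_A E u b))"

text \<open>The block operator matrix with rows \<open>(D, 0)\<close> and \<open>(R, N)\<close>, relative to the
  decomposition of \<open>\<ell>\<^sup>2(V)\<close> into \<open>\<ell>\<^sup>2(U)\<close> and its orthogonal complement; the pair \<open>(h, k)\<close> is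
  identified with the vector \<open>h + k\<close>.\<close>

definition block_op :: "'v set \<Rightarrow> 'v op \<Rightarrow> 'v op \<Rightarrow> 'v op \<Rightarrow> 'v op" where
  "block_op U D R N =
     \<lparr>op_dom = {(\<lambda>v. h v + k v) | h k. h \<in> op_dom D \<inter> op_dom R \<and> k \<in> op_dom N},
      op_app = (\<lambda>x. let h = ell2_proj U x; k = (\<lambda>v. x v - h v)
                    in (\<lambda>v. op_app D h v + (op_app R h v + op_app N k v)))\<rparr>"

definition rank_one_ext ::
  "'v set \<Rightarrow> ('v \<times> 'v) set \<Rightarrow> 'v \<Rightarrow> 'v \<Rightarrow> ('v \<Rightarrow> complex) \<Rightarrow>
   ('v \<Rightarrow> complex) \<Rightarrow> ('v \<Rightarrow> complex) \<Rightarrow> 'v op" where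
  "rank_one_ext V E u b lam f g =
     (let U = join_U V E u b
      in block_op U (diag_op U lam) (oslash_op U f g) (join_N V E u b lam))"

definition compatibility_II :: "'v set \<Rightarrow> ('v \<Rightarrow> complex) \<Rightarrow> ('v \<Rightarrow> complex) \<Rightarrow> bool" where
  "compatibility_II U lam g \<longleftrightarrow>
     (\<lambda>v. (cmod (g v))\<^sup>2 / ((cmod (lam v))\<^sup>2 + 1)) summable_on U"

end

theory Submission
  imports Defs
begin

text \<open>Let \<open>U\<close> be the index set of the diagonal part and split a vector as \<open>x = h + k\<close> with \<open>h\<close>
  supported in \<open>U\<close> and \<open>k\<close> off \<open>U\<close>.  The operator is lower triangular for this splitting, so
  \<open>(W - z) x = y\<close> can be solved by forward substitution: the diagonal row gives
  \<open>h(v) = y(v) / (\<lambda>\<^sub>v - z)\<close>, and the second row becomes \<open>(N - z) k = r\<close> with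
  \<open>r = y - \<langle>h, g\<rangle> f\<close> off \<open>U\<close>.  As \<open>N\<close> is bounded of rank one, this last equation has an
  explicit solution, with \<open>\<parallel>k\<parallel> \<le> 2 \<parallel>r\<parallel> / \<bar>z\<bar>\<close> as soon as \<open>\<bar>z\<bar> \<ge> 2 \<parallel>N\<parallel>\<close>.

  The functional \<open>h \<mapsto> \<langle>h, g\<rangle>\<close> is in general unbounded, but compatibility condition II says that
  it is bounded for the graph norm of the diagonal operator.  Cauchy-Schwarz then gives
  \<open>\<bar>\<langle>h, g\<rangle>\<bar> \<le> K G \<parallel>y\<parallel>\<close> with a constant \<open>G\<close> depending on \<open>g\<close> only, whenever
  \<open>sqrt (\<bar>\<lambda>\<^sub>v\<bar>\<^sup>2 + 1) \<le> K \<bar>\<lambda>\<^sub>v - z\<bar>\<close> for all \<open>v\<close> (lemma \<open>weighted_Cauchy_Schwarz\<close>).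
  Altogether, \<open>resolvent_estimate\<close> bounds the resolvent by a constant over \<open>d\<close>, for any \<open>d\<close>
  that is at most \<open>\<bar>z\<bar>\<close> and at most all \<open>\<bar>\<lambda>\<^sub>v - z\<bar>\<close>.

  It remains to choose a vertex \<open>a\<close> and a wider angle \<open>\<theta>'\<close>, between \<open>\<theta>\<close> and \<open>\<pi> / 2\<close>, such
  that these quantities are controlled by \<open>\<bar>z - a\<bar>\<close> for all \<open>z\<close> outside the sector of angle
  \<open>\<theta>'\<close> at \<open>a\<close>.  Since \<open>\<theta> < \<theta>'\<close>, the inner sector and the complement of the outer one separate
  linearly (\<open>cone_separation\<close>): the distance between a point of one and a point of the other is
  at least a fixed fraction \<open>\<kappa>\<close> of the distance of either point to \<open>a\<close>.  Taking \<open>a < \<alpha>\<close> keeps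
  the \<open>\<lambda>\<^sub>v\<close> away from \<open>a\<close>, which makes \<open>K\<close> independent of \<open>z\<close>; taking \<open>a\<close> very negative puts
  \<open>0\<close> into the inner sector, far from its vertex, which makes \<open>\<bar>z\<bar>\<close> large compared with \<open>\<parallel>N\<parallel>\<close>.\<close>

section \<open>Sectors as convex cones\<close>

text \<open>A condition on the argument is replaced by a comparison of \<open>Re z\<close> with \<open>cos \<theta> * \<bar>z\<bar>\<close>.  In this
  form it needs no case distinction along the branch cut, covers \<open>z = 0\<close>, and exhibits the sector
  as a convex cone.\<close>

lemma Re_eq_cmod_mult_cos_Arg: "Re z = cmod z * cos \<bar>Arg z\<bar>"
proof -
  have "Re z = Re (rcis (cmod z) (Arg z))"
    by (simp add: rcis_cmod_Arg)
  then show ?thesis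
    by simp
qed

lemma abs_Arg_le_pi: "\<bar>Arg z\<bar> \<le> pi"
  using mpi_less_Arg[of z] Arg_le_pi[of z] by linarith

lemma cone_if_abs_Arg_le:
  assumes "\<bar>Arg z\<bar> \<le> \<theta>" "\<theta> \<le> pi"
  shows "cos \<theta> * cmod z \<le> Re z"
  using cos_monotone_0_pi_le[of "\<bar>Arg z\<bar>" \<theta>] assms
  by (simp add: Re_eq_cmod_mult_cos_Arg mult.commute mult_left_mono del: cos_abs_real)

lemma complement_of_cone_if_abs_Arg_ge:
  assumes "\<theta> \<le> \<bar>Arg z\<bar>" "0 \<le> \<theta>"
  shows "Re z \<le> cos \<theta> * cmod z"
  using cos_monotone_0_pi_le[of \<theta> "\<bar>Arg z\<bar>"] assms abs_Arg_le_pi[of z]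
  by (simp add: Re_eq_cmod_mult_cos_Arg mult.commute mult_left_mono del: cos_abs_real)

text \<open>For \<open>0 \<le> t \<le> 1\<close> the function \<open>w \<mapsto> Re w - t * \<bar>w\<bar>\<close> is Lipschitz with constant 2.  For
  \<open>t = c\<close> it is nonnegative at \<open>w\<close> and at most \<open>- (c - c') * \<bar>\<zeta>\<bar>\<close> at \<open>\<zeta>\<close>; for \<open>t = c'\<close> it is at
  least \<open>(c - c') * \<bar>w\<bar>\<close> at \<open>w\<close> and nonpositive at \<open>\<zeta>\<close>.\<close>

lemma cone_separation:
  fixes w \<zeta> :: complex
  assumes c: "0 \<le> c'" "c' \<le> c" "c \<le> 1"
    and w: "c * cmod w \<le> Re w" and \<zeta>: "Re \<zeta> \<le> c' * cmod \<zeta>"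
  shows "(c - c') / 2 * cmod \<zeta> \<le> cmod (w - \<zeta>)"
    and "(c - c') / 2 * cmod w \<le> cmod (w - \<zeta>)"
proof -
  have lipschitz: "(Re w - t * cmod w) - (Re \<zeta> - t * cmod \<zeta>) \<le> 2 * cmod (w - \<zeta>)"
    if "0 \<le> t" "t \<le> 1" for t
  proof -
    have 1: "Re w - Re \<zeta> \<le> cmod (w - \<zeta>)"
      using complex_Re_le_cmod[of "w - \<zeta>"] by simp
    have "t * (cmod \<zeta> - cmod w) \<le> t * cmod (w - \<zeta>)"
      using norm_triangle_ineq2[of \<zeta> w] \<open>0 \<le> t\<close>
      by (intro mult_left_mono) (simp_all add: norm_minus_commute)
    also have "\<dots> \<le> 1 * cmod (w - \<zeta>)"
      using \<open>t \<le> 1\<close> by (intro mult_right_mono) simp_all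
    finally show ?thesis
      using 1 by (simp add: algebra_simps)
  qed
  show "(c - c') / 2 * cmod \<zeta> \<le> cmod (w - \<zeta>)"
    using lipschitz[of c] c w \<zeta> by (simp add: algebra_simps)
  show "(c - c') / 2 * cmod w \<le> cmod (w - \<zeta>)"
    using lipschitz[of c'] c w \<zeta> by (simp add: algebra_simps)
qed


section \<open>The spaces of square-summable functions\<close>

lemma ell2_outside: "h \<in> ell2 V \<Longrightarrow> v \<notin> V \<Longrightarrow> h v = 0"
  by (simp add: ell2_def)

lemma ell2_norm_nonneg [simp]: "0 \<le> ell2_norm V h"
  by (simp add: ell2_norm_def infsum_nonneg)

text \<open>Norm inequalities in \<open>\<ell>\<^sup>2\<close> are obtained from those for finite sections: a finite section is
  bounded by the norm, and a uniform bound on the finite sections gives both membership and a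
  bound on the norm.\<close>

lemma L2_set_le_ell2_norm:
  assumes "h \<in> ell2 V" "finite F" "F \<subseteq> V"
  shows "L2_set (\<lambda>v. cmod (h v)) F \<le> ell2_norm V h"
  unfolding L2_set_def ell2_norm_def
  using assms by (intro real_sqrt_le_mono finite_sum_le_infsum) (auto simp: ell2_def)

lemma cmod_le_ell2_norm:
  assumes "h \<in> ell2 V"
  shows "cmod (h v) \<le> ell2_norm V h"
proof (cases "v \<in> V")
  case True
  then show ?thesis
    using L2_set_le_ell2_norm[OF assms, of "{v}"] by simp
qed (use assms in \<open>simp add: ell2_outside\<close>)

lemma ell2_boundI:
  assumes outside: "\<And>v. v \<notin> V \<Longrightarrow> h v = 0"
    and bound: "\<And>F. finite F \<Longrightarrow> F \<subseteq> V \<Longrightarrow> L2_set (\<lambda>v. cmod (h v)) F \<le> c"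
  shows "h \<in> ell2 V" "ell2_norm V h \<le> c"
proof -
  have "0 \<le> c"
    using bound[of "{}"] by simp
  have sq: "(\<Sum>v\<in>F. (cmod (h v))\<^sup>2) \<le> c\<^sup>2" if "finite F" "F \<subseteq> V" for F
    using bound[OF that] unfolding L2_set_def by (rule sqrt_le_D)
  then have summable: "(\<lambda>v. (cmod (h v))\<^sup>2) summable_on V"
    by (intro nonneg_bdd_above_summable_on bdd_aboveI[of _ "c\<^sup>2"]) auto
  then show "h \<in> ell2 V"
    using outside by (simp add: ell2_def)
  have "(\<Sum>\<^sub>\<infinity>v\<in>V. (cmod (h v))\<^sup>2) \<le> c\<^sup>2"
    by (rule infsum_le_finite_sums[OF summable sq])
  then show "ell2_norm V h \<le> c"
    unfolding ell2_norm_def using \<open>0 \<le> c\<close> by (simp add: real_le_lsqrt)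
qed

lemma ell2_dominated:
  assumes k: "k \<in> ell2 V" and "0 \<le> c"
    and outside: "\<And>v. v \<notin> V \<Longrightarrow> h v = 0"
    and le: "\<And>v. v \<in> V \<Longrightarrow> cmod (h v) \<le> c * cmod (k v)"
  shows "h \<in> ell2 V" "ell2_norm V h \<le> c * ell2_norm V k"
proof -
  have bound: "L2_set (\<lambda>v. cmod (h v)) F \<le> c * ell2_norm V k" if F: "finite F" "F \<subseteq> V" for F
  proof -
    have "L2_set (\<lambda>v. cmod (h v)) F \<le> L2_set (\<lambda>v. c * cmod (k v)) F"
      using F le by (intro L2_set_mono) auto
    also have "\<dots> = c * L2_set (\<lambda>v. cmod (k v)) F"
      using \<open>0 \<le> c\<close> by (simp add: L2_set_right_distrib)
    also have "\<dots> \<le> c * ell2_norm V k"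
      using L2_set_le_ell2_norm[OF k F] \<open>0 \<le> c\<close> by (rule mult_left_mono)
    finally show ?thesis .
  qed
  show "h \<in> ell2 V" "ell2_norm V h \<le> c * ell2_norm V k"
    by (rule ell2_boundI[OF outside bound]; assumption)+
qed

lemma ell2_zero: "(\<lambda>_. 0) \<in> ell2 V"
  by (simp add: ell2_def)

lemma ell2_norm_zero [simp]: "ell2_norm V (\<lambda>_. 0) = 0"
  by (simp add: ell2_norm_def)

lemma ell2_add:
  assumes "h \<in> ell2 V" "k \<in> ell2 V"
  shows "(\<lambda>v. h v + k v) \<in> ell2 V"
    and "ell2_norm V (\<lambda>v. h v + k v) \<le> ell2_norm V h + ell2_norm V k"
proof -
  have bound: "L2_set (\<lambda>v. cmod (h v + k v)) F \<le> ell2_norm V h + ell2_norm V k"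
    if F: "finite F" "F \<subseteq> V" for F
  proof -
    have "L2_set (\<lambda>v. cmod (h v + k v)) F \<le> L2_set (\<lambda>v. cmod (h v) + cmod (k v)) F"
      by (intro L2_set_mono norm_triangle_ineq) auto
    also have "\<dots> \<le> L2_set (\<lambda>v. cmod (h v)) F + L2_set (\<lambda>v. cmod (k v)) F"
      by (rule L2_set_triangle_ineq)
    also have "\<dots> \<le> ell2_norm V h + ell2_norm V k"
      using L2_set_le_ell2_norm[OF _ F] assms by (intro add_mono) auto
    finally show ?thesis .
  qed
  show "(\<lambda>v. h v + k v) \<in> ell2 V"
    "ell2_norm V (\<lambda>v. h v + k v) \<le> ell2_norm V h + ell2_norm V k"
    by (rule ell2_boundI[OF _ bound]; simp add: assms[THEN ell2_outside])+
qed

lemma ell2_scale: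
  assumes "h \<in> ell2 V"
  shows "(\<lambda>v. c * h v) \<in> ell2 V"
    and "ell2_norm V (\<lambda>v. c * h v) \<le> cmod c * ell2_norm V h"
  by (rule ell2_dominated[OF assms, of "cmod c"]; simp add: norm_mult ell2_outside[OF assms])+

lemma ell2_diff:
  assumes "h \<in> ell2 V" "k \<in> ell2 V"
  shows "(\<lambda>v. h v - k v) \<in> ell2 V"
    and "ell2_norm V (\<lambda>v. h v - k v) \<le> ell2_norm V h + ell2_norm V k"
  using ell2_add[OF assms(1) ell2_scale(1)[OF assms(2), of "-1"]]
    ell2_scale(2)[OF assms(2), of "-1"] by simp_all

lemma ell2_proj:
  assumes "h \<in> ell2 V"
  shows "ell2_proj S h \<in> ell2 V" "ell2_norm V (ell2_proj S h) \<le> ell2_norm V h"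
  using ell2_dominated[OF assms, of 1 "ell2_proj S h"]
  by (auto simp: ell2_proj_def ell2_outside[OF assms])

lemma unit_vec_in_ell2:
  assumes "w \<in> V"
  shows "unit_vec w \<in> ell2 V" "ell2_norm V (unit_vec w) \<le> 1"
proof -
  have bound: "L2_set (\<lambda>v. cmod (unit_vec w v)) F \<le> 1" if "finite F" for F
  proof -
    have "(\<Sum>v\<in>F. (cmod (unit_vec w v))\<^sup>2) = (\<Sum>v\<in>F. if v = w then 1 else 0)"
      by (intro sum.cong) (auto simp: unit_vec_def)
    then show ?thesis
      using that by (simp add: L2_set_def)
  qed
  have outside: "unit_vec w v = 0" if "v \<notin> V" for v
    using that assms by (auto simp: unit_vec_def)
  show "unit_vec w \<in> ell2 V" "ell2_norm V (unit_vec w) \<le> 1"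
    by (rule ell2_boundI[OF outside bound]; assumption)+
qed

lemma ell2_subset_iff:
  assumes "U \<subseteq> V"
  shows "h \<in> ell2 U \<longleftrightarrow> h \<in> ell2 V \<and> (\<forall>v. v \<notin> U \<longrightarrow> h v = 0)"
proof -
  have "(\<lambda>v. (cmod (h v))\<^sup>2) summable_on U \<longleftrightarrow> (\<lambda>v. (cmod (h v))\<^sup>2) summable_on V"
    if "\<forall>v. v \<notin> U \<longrightarrow> h v = 0"
    using that assms by (intro summable_on_cong_neutral) auto
  then show ?thesis
    using assms by (auto simp: ell2_def)
qed

lemma ell2_inner_unit_vec:
  assumes "w \<in> V"
  shows "ell2_inner V (unit_vec w) k = cnj (k w)"
proof -
  have "ell2_inner V (unit_vec w) k = (\<Sum>\<^sub>\<infinity>v\<in>{w}. cnj (k v))"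
    unfolding ell2_inner_def using assms
    by (intro infsum_cong_neutral) (auto simp: unit_vec_def)
  then show ?thesis
    by simp
qed

lemma ell2_compl_eq:
  assumes "U \<subseteq> V"
  shows "ell2_compl V (ell2 U) = {k \<in> ell2 V. \<forall>v\<in>U. k v = 0}"
proof (intro set_eqI iffI)
  fix k assume k: "k \<in> ell2_compl V (ell2 U)"
  have "k v = 0" if "v \<in> U" for v
  proof -
    have "ell2_inner V (unit_vec v) k = 0"
      using k unit_vec_in_ell2(1)[OF that] by (simp add: ell2_compl_def)
    then show ?thesis
      using that assms by (simp add: ell2_inner_unit_vec subsetD)
  qed
  then show "k \<in> {k \<in> ell2 V. \<forall>v\<in>U. k v = 0}"
    using k by (simp add: ell2_compl_def)
next
  fix k assume k: "k \<in> {k \<in> ell2 V. \<forall>v\<in>U. k v = 0}"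
  have "ell2_inner V h k = 0" if "h \<in> ell2 U" for h
    unfolding ell2_inner_def
  proof (rule infsum_0)
    fix v
    show "h v * cnj (k v) = 0"
      using k ell2_outside[OF that, of v] by (cases "v \<in> U") auto
  qed
  then show "k \<in> ell2_compl V (ell2 U)"
    using k by (simp add: ell2_compl_def)
qed

text \<open>Factor \<open>h g = (w h) (g / w)\<close>: the second factor is square-summable and the first one is dominated
  by the \<open>\<ell>\<^sup>2\<close> function \<open>p\<close>.  With \<open>w = sqrt (\<bar>\<lambda>\<bar>\<^sup>2 + 1)\<close> this turns compatibility condition II into
  a bound on \<open>\<langle>h, g\<rangle>\<close>, although \<open>g\<close> itself need not be in \<open>\<ell>\<^sup>2\<close>.\<close>

lemma weighted_Cauchy_Schwarz:
  fixes w :: "'v \<Rightarrow> real"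
  assumes p: "p \<in> ell2 V" and "U \<subseteq> V" and "0 \<le> K"
    and w: "\<And>v. v \<in> U \<Longrightarrow> 0 < w v"
    and g: "(\<lambda>v. (cmod (g v) / w v)\<^sup>2) summable_on U"
    and h: "\<And>v. v \<in> U \<Longrightarrow> w v * cmod (h v) \<le> K * cmod (p v)"
  shows "(\<lambda>v. h v * cnj (g v)) summable_on U"
    and "cmod (\<Sum>\<^sub>\<infinity>v\<in>U. h v * cnj (g v))
           \<le> K * sqrt (\<Sum>\<^sub>\<infinity>v\<in>U. (cmod (g v) / w v)\<^sup>2) * ell2_norm V p"
proof -
  let ?t = "\<lambda>v. h v * cnj (g v)"
  let ?G = "sqrt (\<Sum>\<^sub>\<infinity>v\<in>U. (cmod (g v) / w v)\<^sup>2)"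
  have bound: "(\<Sum>v\<in>F. cmod (?t v)) \<le> K * ?G * ell2_norm V p" if F: "finite F" "F \<subseteq> U" for F
  proof -
    have le: "cmod (?t v) \<le> K * (\<bar>cmod (p v)\<bar> * \<bar>cmod (g v) / w v\<bar>)" if "v \<in> F" for v
    proof -
      have "v \<in> U"
        using that F by blast
      have "cmod (?t v) = (w v * cmod (h v)) * (cmod (g v) / w v)"
        using w[OF \<open>v \<in> U\<close>] by (simp add: norm_mult)
      also have "\<dots> \<le> (K * cmod (p v)) * (cmod (g v) / w v)"
        using h[OF \<open>v \<in> U\<close>] w[OF \<open>v \<in> U\<close>] by (intro mult_right_mono) simp_all
      finally show ?thesis
        using w[OF \<open>v \<in> U\<close>] by (simp add: mult.assoc)
    qed
    have "(\<Sum>v\<in>F. cmod (?t v)) \<le> (\<Sum>v\<in>F. K * (\<bar>cmod (p v)\<bar> * \<bar>cmod (g v) / w v\<bar>))"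
      using le by (rule sum_mono)
    also have "\<dots> = K * (\<Sum>v\<in>F. \<bar>cmod (p v)\<bar> * \<bar>cmod (g v) / w v\<bar>)"
      by (simp only: sum_distrib_left)
    also have "\<dots> \<le> K * (L2_set (\<lambda>v. cmod (p v)) F * L2_set (\<lambda>v. cmod (g v) / w v) F)"
      using L2_set_mult_ineq \<open>0 \<le> K\<close> by (rule mult_left_mono)
    also have "\<dots> \<le> K * (ell2_norm V p * ?G)"
    proof (intro mult_left_mono mult_mono \<open>0 \<le> K\<close>)
      show "L2_set (\<lambda>v. cmod (p v)) F \<le> ell2_norm V p"
        using F \<open>U \<subseteq> V\<close> by (intro L2_set_le_ell2_norm[OF p]) auto
      show "L2_set (\<lambda>v. cmod (g v) / w v) F \<le> ?G"
        unfolding L2_set_def using F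
        by (intro real_sqrt_le_mono finite_sum_le_infsum[OF g]) auto
    qed simp_all
    finally show ?thesis
      by (simp add: mult_ac)
  qed
  have abs: "(\<lambda>v. cmod (?t v)) summable_on U"
    using bound by (intro nonneg_bdd_above_summable_on bdd_aboveI[of _ "K * ?G * ell2_norm V p"]) auto
  then show "?t summable_on U"
    by (rule abs_summable_summable)
  have "cmod (infsum ?t U) \<le> (\<Sum>\<^sub>\<infinity>v\<in>U. cmod (?t v))"
    by (rule norm_infsum_bound[OF abs])
  also have "\<dots> \<le> K * ?G * ell2_norm V p"
    by (rule infsum_le_finite_sums[OF abs bound])
  finally show "cmod (infsum ?t U) \<le> K * ?G * ell2_norm V p" .
qed

lemma ell2_finite_sections_dense:
  assumes x: "x \<in> ell2 V" and "0 < \<epsilon>"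
  obtains F where "finite F" "F \<subseteq> V" "ell2_norm V (\<lambda>v. x v - ell2_proj F x v) < \<epsilon>"
proof -
  let ?q = "\<lambda>v. (cmod (x v))\<^sup>2"
  have summable: "?q summable_on V"
    using x by (simp add: ell2_def)
  have "0 < (\<epsilon> / 2)\<^sup>2"
    using \<open>0 < \<epsilon>\<close> by simp
  obtain F where F: "finite F" "F \<subseteq> V" and close: "dist (sum ?q F) (infsum ?q V) \<le> (\<epsilon> / 2)\<^sup>2"
    using infsum_finite_approximation[OF summable \<open>0 < (\<epsilon> / 2)\<^sup>2\<close>] by blast
  have "L2_set (\<lambda>v. cmod (x v - ell2_proj F x v)) F' \<le> \<epsilon> / 2" if F': "finite F'" "F' \<subseteq> V" for F'
  proof -
    have "(\<Sum>v\<in>F'. (cmod (x v - ell2_proj F x v))\<^sup>2) = (\<Sum>v\<in>F' - F. ?q v)"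
      using F' by (intro sum.mono_neutral_cong_right) (auto simp: ell2_proj_def)
    also have "\<dots> = (\<Sum>v\<in>(F' - F) \<union> F. ?q v) - (\<Sum>v\<in>F. ?q v)"
      using F F' by (subst sum.union_disjoint) auto
    also have "\<dots> \<le> infsum ?q V - (\<Sum>v\<in>F. ?q v)"
      using F F' by (intro diff_right_mono finite_sum_le_infsum[OF summable]) auto
    also have "\<dots> \<le> (\<epsilon> / 2)\<^sup>2"
      using close by (simp add: dist_real_def)
    finally show ?thesis
      unfolding L2_set_def using \<open>0 < \<epsilon>\<close> by (intro real_le_lsqrt) simp_all
  qed
  then have "ell2_norm V (\<lambda>v. x v - ell2_proj F x v) \<le> \<epsilon> / 2"
    by (intro ell2_boundI; simp add: ell2_proj_def ell2_outside[OF x])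
  then show thesis
    using F \<open>0 < \<epsilon>\<close> by (intro that) auto
qed


section \<open>Resolvents from explicit inverses\<close>

text \<open>The resolvent is a choice of preimages under \<open>T - z\<close>.  A two-sided inverse \<open>R\<close> shows that there is
  no choice, so that every bound on \<open>R\<close> is a bound on the resolvent.\<close>

lemma resolvent_setI:
  assumes inverse: "\<And>y. y \<in> ell2 V \<Longrightarrow> R y \<in> op_dom T"
      "\<And>y. y \<in> ell2 V \<Longrightarrow> (\<lambda>v. op_app T (R y) v - z * R y v) = y"
      "\<And>x. x \<in> op_dom T \<Longrightarrow> (\<lambda>v. op_app T x v - z * x v) \<in> ell2 V"
      "\<And>x. x \<in> op_dom T \<Longrightarrow> R (\<lambda>v. op_app T x v - z * x v) = x"
    and "0 \<le> C" and bound: "\<And>y. y \<in> ell2 V \<Longrightarrow> ell2_norm V (R y) \<le> C * ell2_norm V y"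
  shows "z \<in> resolvent_set V T" "ell2_opnorm V (resolvent T z) \<le> C"
proof -
  let ?S = "op_app (op_shift T z)"
  have bij: "bij_betw ?S (op_dom T) (ell2 V)"
    using inverse by (intro bij_betw_byWitness[where f' = R]) (auto simp: op_shift_def)
  have resolvent: "resolvent T z y = R y" if "y \<in> ell2 V" for y
  proof -
    have "inv_into (op_dom T) ?S (?S (R y)) = R y"
      using bij inverse(1)[OF that] by (intro inv_into_f_f) (auto simp: bij_betw_def)
    then show ?thesis
      using inverse(2)[OF that] by (simp add: resolvent_def op_shift_def)
  qed
  show "z \<in> resolvent_set V T"
    using bij bound resolvent
    by (auto simp: resolvent_set_def ell2_bounded_def op_shift_def intro!: exI[of _ C])
  show "ell2_opnorm V (resolvent T z) \<le> C"
    unfolding ell2_opnorm_def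
  proof (rule cSUP_least)
    show "{x \<in> ell2 V. ell2_norm V x \<le> 1} \<noteq> {}"
      using ell2_zero[of V] ell2_norm_zero[of V] by force
    fix y assume y: "y \<in> {x \<in> ell2 V. ell2_norm V x \<le> 1}"
    then have "ell2_norm V (resolvent T z y) \<le> C * ell2_norm V y"
      using bound resolvent by simp
    also have "\<dots> \<le> C * 1"
      using y \<open>0 \<le> C\<close> by (intro mult_left_mono) auto
    finally show "ell2_norm V (resolvent T z y) \<le> C"
      by simp
  qed
qed


section \<open>Lower triangular rank one perturbations of diagonal operators\<close>

text \<open>The \<open>\<ell>\<^sup>2\<close> norm of \<open>h\<close> weighted by this function is the graph norm of the diagonal operator.\<close>

definition graph_weight :: "('v \<Rightarrow> complex) \<Rightarrow> 'v \<Rightarrow> real" where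
  "graph_weight lam v = sqrt ((cmod (lam v))\<^sup>2 + 1)"

lemma graph_weight_pos: "0 < graph_weight lam v"
  by (simp add: graph_weight_def add_nonneg_pos)

lemma graph_weight_le: "graph_weight lam v \<le> cmod (lam v) + 1"
  unfolding graph_weight_def by (rule real_le_lsqrt) (simp_all add: power2_sum)

lemma cmod_lam_le_graph_weight: "cmod (lam v) \<le> graph_weight lam v"
  unfolding graph_weight_def by (rule real_le_rsqrt) simp

lemma compatibility_II_weighted:
  "compatibility_II U lam g \<Longrightarrow> (\<lambda>v. (cmod (g v) / graph_weight lam v)\<^sup>2) summable_on U"
  by (simp add: compatibility_II_def graph_weight_def power_divide)

text \<open>Under compatibility condition II the domain of the diagonal operator is contained in that of the
  unbounded rank one part, so it alone determines the domain of the triangular operator.  The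
  dominating \<open>\<ell>\<^sup>2\<close> function is \<open>\<bar>\<lambda> x\<bar> + \<bar>x\<bar>\<close>.\<close>

lemma summable_on_diagonal_domain:
  assumes compat: "compatibility_II U lam g" and "U \<subseteq> V"
    and x: "x \<in> ell2 V" and lam_x: "ell2_proj U (\<lambda>v. lam v * x v) \<in> ell2 V"
  shows "(\<lambda>v. x v * cnj (g v)) summable_on U"
proof (rule weighted_Cauchy_Schwarz(1)[OF _ \<open>U \<subseteq> V\<close> _ graph_weight_pos])
  let ?p = "\<lambda>v. of_real (cmod (ell2_proj U (\<lambda>v. lam v * x v) v)) + of_real (cmod (x v)) :: complex"
  have abs: "(\<lambda>v. of_real (cmod (h v)) :: complex) \<in> ell2 V" if "h \<in> ell2 V" for h
    using that by (simp add: ell2_def)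
  show "?p \<in> ell2 V"
    by (intro ell2_add abs x lam_x)
  show "graph_weight lam v * cmod (x v) \<le> 1 * cmod (?p v)" if "v \<in> U" for v
  proof -
    have "graph_weight lam v * cmod (x v) \<le> (cmod (lam v) + 1) * cmod (x v)"
      by (intro mult_right_mono graph_weight_le) simp
    also have "\<dots> = cmod (ell2_proj U (\<lambda>v. lam v * x v) v) + cmod (x v)"
      using that by (simp add: ell2_proj_def norm_mult algebra_simps)
    also have "\<dots> = cmod (?p v)"
      by (simp flip: of_real_add)
    finally show ?thesis
      by simp
  qed
qed (use compatibility_II_weighted[OF compat] in simp_all)

text \<open>In this description of the operator the block structure is made pointwise.  The bounded rank one
  part is \<open>x \<mapsto> (\<Sum>v\<in>B. c v * x v) e\<^sub>u\<close>; as \<open>B\<close> avoids \<open>U\<close>, it sees the second component of \<open>x\<close>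
  only.  The condition on \<open>op_app T\<close> is restricted to the domain, because values elsewhere are
  arbitrary.\<close>

locale triangular_rank_one =
  fixes V U B :: "'v set" and u :: 'v and lam c f g :: "'v \<Rightarrow> complex" and T :: "'v op"
  assumes U_subset: "U \<subseteq> V" and u_in: "u \<in> V" and u_notin: "u \<notin> U"
    and finite_B: "finite B" and B_disjoint: "B \<inter> U = {}"
    and f_in: "f \<in> ell2 V" and f_zero: "\<And>v. v \<in> U \<Longrightarrow> f v = 0"
    and compat: "compatibility_II U lam g"
    and dom_T: "op_dom T = {x \<in> ell2 V. ell2_proj U (\<lambda>v. lam v * x v) \<in> ell2 V}"
    and app_T: "\<And>x. x \<in> op_dom T \<Longrightarrow> op_app T x =
      (\<lambda>v. ell2_proj U (\<lambda>v. lam v * x v) v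
           + ((\<Sum>\<^sub>\<infinity>v\<in>U. x v * cnj (g v)) * f v + (\<Sum>v\<in>B. c v * x v) * unit_vec u v))"
begin

abbreviation g_form :: "('v \<Rightarrow> complex) \<Rightarrow> complex" where
  "g_form x \<equiv> \<Sum>\<^sub>\<infinity>v\<in>U. x v * cnj (g v)"

abbreviation c_form :: "('v \<Rightarrow> complex) \<Rightarrow> complex" where
  "c_form x \<equiv> \<Sum>v\<in>B. c v * x v"

definition g_bound :: real where
  "g_bound = sqrt (\<Sum>\<^sub>\<infinity>v\<in>U. (cmod (g v) / graph_weight lam v)\<^sup>2)"

definition c_bound :: real where
  "c_bound = (\<Sum>v\<in>B. cmod (c v))"

lemma g_bound_nonneg: "0 \<le> g_bound"
  by (simp add: g_bound_def infsum_nonneg)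

lemma c_bound_nonneg: "0 \<le> c_bound"
  by (simp add: c_bound_def sum_nonneg)

lemma g_form_bounded:
  assumes "p \<in> ell2 V" "0 \<le> K"
    and "\<And>v. v \<in> U \<Longrightarrow> graph_weight lam v * cmod (h v) \<le> K * cmod (p v)"
  shows "cmod (g_form h) \<le> K * g_bound * ell2_norm V p"
  unfolding g_bound_def
  by (rule weighted_Cauchy_Schwarz(2)[OF assms(1) U_subset assms(2) graph_weight_pos
        compatibility_II_weighted[OF compat] assms(3)])

lemma g_form_summable: "x \<in> op_dom T \<Longrightarrow> (\<lambda>v. x v * cnj (g v)) summable_on U"
  using summable_on_diagonal_domain[OF compat U_subset] by (simp add: dom_T)

lemma c_form_bounded:
  assumes "x \<in> ell2 V"
  shows "cmod (c_form x) \<le> c_bound * ell2_norm V x"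
proof -
  have "cmod (c_form x) \<le> (\<Sum>v\<in>B. cmod (c v * x v))"
    by (rule norm_sum)
  also have "\<dots> \<le> (\<Sum>v\<in>B. cmod (c v) * ell2_norm V x)"
    by (intro sum_mono) (auto simp: norm_mult intro!: mult_left_mono cmod_le_ell2_norm[OF assms])
  finally show ?thesis
    by (simp add: c_bound_def sum_distrib_right)
qed

lemma app_T_in_ell2: "x \<in> op_dom T \<Longrightarrow> op_app T x \<in> ell2 V"
  unfolding app_T
  by (intro ell2_add ell2_scale f_in unit_vec_in_ell2 u_in) (simp add: dom_T)

lemma linear_T: "linear_op V T"
  unfolding linear_op_def
proof (intro conjI ballI allI)
  show "op_dom T \<subseteq> ell2 V" "op_app T ` op_dom T \<subseteq> ell2 V"
    using app_T_in_ell2 by (auto simp: dom_T)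
  show "(\<lambda>_. 0) \<in> op_dom T"
    by (simp add: dom_T ell2_zero ell2_proj_def cong: if_cong)
  fix x assume x: "x \<in> op_dom T"
  {
    fix y assume y: "y \<in> op_dom T"
    have proj: "ell2_proj U (\<lambda>v. lam v * (x v + y v)) =
        (\<lambda>v. ell2_proj U (\<lambda>v. lam v * x v) v + ell2_proj U (\<lambda>v. lam v * y v) v)"
      by (auto simp: ell2_proj_def algebra_simps)
    show sum: "(\<lambda>v. x v + y v) \<in> op_dom T"
      using x y unfolding dom_T mem_Collect_eq proj by (intro conjI ell2_add) auto
    have "g_form (\<lambda>v. x v + y v) = g_form x + g_form y"
      using infsum_add[OF g_form_summable[OF x] g_form_summable[OF y]]
      by (simp add: algebra_simps)
    then show "op_app T (\<lambda>v. x v + y v) = (\<lambda>v. op_app T x v + op_app T y v)"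
      unfolding app_T[OF x] app_T[OF y] app_T[OF sum] proj
      by (auto simp: algebra_simps sum.distrib)
  next
    fix a :: complex
    have proj: "ell2_proj U (\<lambda>v. lam v * (a * x v)) = (\<lambda>v. a * ell2_proj U (\<lambda>v. lam v * x v) v)"
      by (auto simp: ell2_proj_def)
    show scale: "(\<lambda>v. a * x v) \<in> op_dom T"
      using x unfolding dom_T mem_Collect_eq proj by (intro conjI ell2_scale) auto
    have "g_form (\<lambda>v. a * x v) = a * g_form x"
      by (simp add: mult.assoc infsum_cmult_right')
    moreover have "c_form (\<lambda>v. a * x v) = a * c_form x"
      by (simp add: sum_distrib_left mult_ac)
    ultimately show "op_app T (\<lambda>v. a * x v) = (\<lambda>v. a * op_app T x v)"
      unfolding app_T[OF x] app_T[OF scale] proj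
      by (auto simp: algebra_simps)
  }
qed

lemma dense_T: "densely_defined V T"
  unfolding densely_defined_def
proof (intro ballI allI impI)
  fix x :: "'v \<Rightarrow> complex" and \<epsilon> :: real
  assume x: "x \<in> ell2 V" and "0 < \<epsilon>"
  obtain F where F: "finite F" "F \<subseteq> V" and less: "ell2_norm V (\<lambda>v. x v - ell2_proj F x v) < \<epsilon>"
    using ell2_finite_sections_dense[OF x \<open>0 < \<epsilon>\<close>] by blast
  let ?y = "ell2_proj F x"
  let ?K = "\<Sum>w\<in>F. cmod (lam w)"
  have "ell2_proj U (\<lambda>v. lam v * ?y v) \<in> ell2 V"
  proof (rule ell2_dominated(1)[OF x])
    show "0 \<le> ?K"
      by (simp add: sum_nonneg)
    show "cmod (ell2_proj U (\<lambda>v. lam v * ?y v) v) \<le> ?K * cmod (x v)" for v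
    proof (cases "v \<in> F")
      case True
      then have "cmod (lam v) \<le> ?K"
        using F by (intro member_le_sum) auto
      then show ?thesis
        by (auto simp: ell2_proj_def norm_mult sum_nonneg intro!: mult_right_mono)
    qed (simp add: ell2_proj_def sum_nonneg)
    show "ell2_proj U (\<lambda>v. lam v * ?y v) v = 0" if "v \<notin> V" for v
      using that F by (auto simp: ell2_proj_def)
  qed
  then have "?y \<in> op_dom T"
    using ell2_proj(1)[OF x] by (simp add: dom_T)
  then show "\<exists>y\<in>op_dom T. ell2_norm V (\<lambda>v. x v - y v) < \<epsilon>"
    using less by blast
qed

text \<open>Forward substitution for \<open>(T - z) x = y\<close>.  Once \<open>x\<close> is known on \<open>U\<close>, the equation off \<open>U\<close> reads
  \<open>\<phi>(x) e\<^sub>u - z x = r\<close>, where \<open>r\<close> is the remainder and \<open>\<phi>\<close> stands for \<open>c_form\<close>.  Applying \<open>\<phi>\<close>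
  gives the scalar equation \<open>\<phi>(x) (\<phi>(e\<^sub>u) - z) = \<phi>(r)\<close>; its solution \<open>\<phi>(x)\<close> is the resolvent
  coefficient, and then \<open>x = (\<phi>(x) e\<^sub>u - r) / z\<close> off \<open>U\<close>.\<close>

definition remainder :: "complex \<Rightarrow> ('v \<Rightarrow> complex) \<Rightarrow> 'v \<Rightarrow> complex" where
  "remainder z y = (\<lambda>v. y v - g_form (\<lambda>v. y v / (lam v - z)) * f v)"

definition resolvent_coeff :: "complex \<Rightarrow> ('v \<Rightarrow> complex) \<Rightarrow> complex" where
  "resolvent_coeff z y = c_form (remainder z y) / (c_form (unit_vec u) - z)"

definition explicit_resolvent :: "complex \<Rightarrow> ('v \<Rightarrow> complex) \<Rightarrow> 'v \<Rightarrow> complex" where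
  "explicit_resolvent z y = (\<lambda>v. if v \<in> U then y v / (lam v - z)
     else (resolvent_coeff z y * unit_vec u v - remainder z y v) / z)"

lemma c_form_cong: "(\<And>v. v \<notin> U \<Longrightarrow> x v = y v) \<Longrightarrow> c_form x = c_form y"
  using B_disjoint by (intro sum.cong) auto

lemma c_form_linear:
  "c_form (\<lambda>v. a * x v - b * y v) = a * c_form x - b * c_form y"
  by (simp add: sum_subtractf sum_distrib_left algebra_simps)

text \<open>In the numerator, the first summand 1 is the contribution of the diagonal row.  The rest is
  \<open>2 \<parallel>r\<parallel>\<close>, since \<open>\<parallel>r\<parallel> \<le> (1 + K * g_bound * \<parallel>f\<parallel>) \<parallel>y\<parallel>\<close> and the condition \<open>\<bar>z\<bar> \<ge> 2 * c_bound\<close>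
  bounds the resolvent coefficient by \<open>\<parallel>r\<parallel>\<close>.\<close>

lemma resolvent_estimate:
  assumes "0 < d" and dist: "\<And>v. v \<in> U \<Longrightarrow> d \<le> cmod (lam v - z)"
    and "0 \<le> K" and weight: "\<And>v. v \<in> U \<Longrightarrow> graph_weight lam v \<le> K * cmod (lam v - z)"
    and "d \<le> cmod z" "2 * c_bound \<le> cmod z"
  shows "z \<in> resolvent_set V T"
    and "ell2_opnorm V (resolvent T z) \<le> (1 + 2 * (1 + K * g_bound * ell2_norm V f)) / d"
proof -
  let ?e = "unit_vec u"
  let ?C = "(1 + 2 * (1 + K * g_bound * ell2_norm V f)) / d"
  have z: "0 < cmod z" "z \<noteq> 0"
    using \<open>0 < d\<close> \<open>d \<le> cmod z\<close> by auto
  have nonzero: "lam v - z \<noteq> 0" if "v \<in> U" for v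
    using dist[OF that] \<open>0 < d\<close> by auto
  have "cmod (c_form ?e) \<le> c_bound * ell2_norm V ?e"
    by (intro c_form_bounded unit_vec_in_ell2 u_in)
  also have "\<dots> \<le> c_bound"
    using mult_left_mono[OF unit_vec_in_ell2(2)[OF u_in] c_bound_nonneg] by simp
  finally have "cmod (c_form ?e) \<le> c_bound" .
  then have gap: "cmod z / 2 \<le> cmod (c_form ?e - z)"
    using norm_triangle_ineq2[of z "c_form ?e"] \<open>2 * c_bound \<le> cmod z\<close>
    by (simp add: norm_minus_commute)
  then have gap_nonzero: "c_form ?e - z \<noteq> 0"
    using z by auto
  have R: "explicit_resolvent z y \<in> op_dom T"
      "(\<lambda>v. op_app T (explicit_resolvent z y) v - z * explicit_resolvent z y v) = y"
      "ell2_norm V (explicit_resolvent z y) \<le> ?C * ell2_norm V y" if y: "y \<in> ell2 V" for y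
  proof -
    let ?h = "\<lambda>v. y v / (lam v - z)"
    let ?r = "remainder z y" and ?s = "resolvent_coeff z y"
    let ?R = "explicit_resolvent z y"
    let ?k = "\<lambda>v. 1 / z * (?s * ?e v - ?r v)"
    have weighted: "graph_weight lam v * cmod (?h v) \<le> K * cmod (y v)" if "v \<in> U" for v
      using mult_right_mono[OF weight[OF that], of "cmod (?h v)"] nonzero[OF that]
      by (simp add: norm_divide)
    note g = g_form_bounded[OF y \<open>0 \<le> K\<close> weighted]
    have r_in: "?r \<in> ell2 V"
      unfolding remainder_def by (intro ell2_diff ell2_scale y f_in)
    have "ell2_norm V ?r \<le> ell2_norm V y + ell2_norm V (\<lambda>v. g_form ?h * f v)"
      unfolding remainder_def by (intro ell2_diff ell2_scale y f_in)
    also have "\<dots> \<le> ell2_norm V y + cmod (g_form ?h) * ell2_norm V f"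
      by (intro add_left_mono ell2_scale f_in)
    also have "\<dots> \<le> ell2_norm V y + K * g_bound * ell2_norm V y * ell2_norm V f"
      using g by (intro add_left_mono mult_right_mono) simp_all
    also have "\<dots> = (1 + K * g_bound * ell2_norm V f) * ell2_norm V y"
      by (simp add: algebra_simps)
    finally have r_bound: "ell2_norm V ?r \<le> (1 + K * g_bound * ell2_norm V f) * ell2_norm V y" .
    have s_bound: "cmod ?s \<le> ell2_norm V ?r"
    proof -
      have "cmod (c_form ?r) \<le> c_bound * ell2_norm V ?r"
        by (rule c_form_bounded[OF r_in])
      also have "\<dots> \<le> cmod z / 2 * ell2_norm V ?r"
        using \<open>2 * c_bound \<le> cmod z\<close> by (intro mult_right_mono) simp_all
      also have "\<dots> \<le> cmod (c_form ?e - z) * ell2_norm V ?r"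
        using gap by (intro mult_right_mono) simp_all
      finally show ?thesis
        using gap_nonzero by (simp add: resolvent_coeff_def norm_divide field_simps)
    qed
    have k_in: "?k \<in> ell2 V"
      by (intro ell2_scale ell2_diff r_in unit_vec_in_ell2 u_in)
    have "ell2_norm V ?k \<le> cmod (1 / z) * ell2_norm V (\<lambda>v. ?s * ?e v - ?r v)"
      by (intro ell2_scale ell2_diff r_in unit_vec_in_ell2 u_in)
    also have "\<dots> \<le> cmod (1 / z) * (2 * ell2_norm V ?r)"
    proof (rule mult_left_mono)
      have "ell2_norm V (\<lambda>v. ?s * ?e v - ?r v) \<le> ell2_norm V (\<lambda>v. ?s * ?e v) + ell2_norm V ?r"
        by (intro ell2_scale ell2_diff r_in unit_vec_in_ell2 u_in)
      moreover have "ell2_norm V (\<lambda>v. ?s * ?e v) \<le> cmod ?s * ell2_norm V ?e"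
        by (intro ell2_scale unit_vec_in_ell2 u_in)
      moreover have "cmod ?s * ell2_norm V ?e \<le> cmod ?s"
        using mult_left_mono[OF unit_vec_in_ell2(2)[OF u_in], of "cmod ?s"] by simp
      ultimately show "ell2_norm V (\<lambda>v. ?s * ?e v - ?r v) \<le> 2 * ell2_norm V ?r"
        using s_bound by linarith
    qed simp
    also have "\<dots> \<le> 1 / d * (2 * ell2_norm V ?r)"
      using z \<open>0 < d\<close> \<open>d \<le> cmod z\<close>
      by (intro mult_right_mono) (simp_all add: norm_divide frac_le)
    also have "\<dots> \<le> 1 / d * (2 * ((1 + K * g_bound * ell2_norm V f) * ell2_norm V y))"
      using r_bound \<open>0 < d\<close> by (intro mult_left_mono) simp_all
    finally have k_bound: "ell2_norm V ?k
        \<le> 1 / d * (2 * ((1 + K * g_bound * ell2_norm V f) * ell2_norm V y))" .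
    have h_le: "cmod (ell2_proj U ?h v) \<le> 1 / d * cmod (y v)" for v
    proof (cases "v \<in> U")
      case True
      then show ?thesis
        using dist[OF True] \<open>0 < d\<close>
        by (simp add: ell2_proj_def norm_divide frac_le)
    qed (use \<open>0 < d\<close> in \<open>simp add: ell2_proj_def\<close>)
    have outside: "ell2_proj U w v = 0" if "v \<notin> V" for w :: "'v \<Rightarrow> complex" and v
      using that U_subset by (auto simp: ell2_proj_def)
    have h_in: "ell2_proj U ?h \<in> ell2 V" and
      h_bound: "ell2_norm V (ell2_proj U ?h) \<le> 1 / d * ell2_norm V y"
      using ell2_dominated[OF y _ outside h_le] \<open>0 < d\<close> by simp_all
    have split: "?R = (\<lambda>v. ell2_proj U ?h v + ell2_proj (- U) ?k v)"
      by (auto simp: explicit_resolvent_def ell2_proj_def)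
    have R_in: "?R \<in> ell2 V"
      unfolding split by (intro ell2_add h_in ell2_proj k_in)
    have "ell2_proj U (\<lambda>v. lam v * ?R v) \<in> ell2 V"
    proof (rule ell2_dominated(1)[OF y \<open>0 \<le> K\<close>])
      show "cmod (ell2_proj U (\<lambda>v. lam v * ?R v) v) \<le> K * cmod (y v)" for v
      proof (cases "v \<in> U")
        case True
        have "cmod (lam v) * cmod (?h v) \<le> graph_weight lam v * cmod (?h v)"
          by (intro mult_right_mono cmod_lam_le_graph_weight) simp
        also note weighted[OF True]
        finally show ?thesis
          using True by (simp add: ell2_proj_def explicit_resolvent_def norm_mult norm_divide)
      qed (use \<open>0 \<le> K\<close> in \<open>simp add: ell2_proj_def\<close>)
    qed (rule outside)
    with R_in show R_dom: "?R \<in> op_dom T"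
      by (simp add: dom_T)
    have g_R: "g_form ?R = g_form ?h"
      by (rule infsum_cong) (simp add: explicit_resolvent_def)
    have c_R: "c_form ?R = ?s"
    proof -
      have "c_form ?R = c_form (\<lambda>v. ?s / z * ?e v - 1 / z * ?r v)"
        by (rule c_form_cong) (simp add: explicit_resolvent_def diff_divide_distrib)
      also have "\<dots> = ?s / z * c_form ?e - 1 / z * c_form ?r"
        by (rule c_form_linear)
      also have "c_form ?r = ?s * (c_form ?e - z)"
        using gap_nonzero by (simp add: resolvent_coeff_def)
      finally show ?thesis
        using \<open>z \<noteq> 0\<close> by (simp add: field_simps)
    qed
    show "(\<lambda>v. op_app T ?R v - z * ?R v) = y"
    proof
      fix v
      show "op_app T ?R v - z * ?R v = y v"
      proof (cases "v \<in> U")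
        case True
        then have "unit_vec u v = 0" "?R v = ?h v"
          using u_notin by (auto simp: unit_vec_def explicit_resolvent_def)
        with True have "op_app T ?R v - z * ?R v = (lam v - z) * ?h v"
          unfolding app_T[OF R_dom]
          by (simp only: ell2_proj_def f_zero)
            (simp only: if_True left_diff_distrib mult_zero_right add_0_right)
        then show ?thesis
          using nonzero[OF True] by simp
      next
        case False
        then have "z * ?R v = ?s * ?e v - ?r v"
          using \<open>z \<noteq> 0\<close> by (simp add: explicit_resolvent_def)
        then show ?thesis
          using False unfolding app_T[OF R_dom] g_R c_R
          by (simp only: ell2_proj_def remainder_def if_False) simp
      qed
    qed
    have "ell2_norm V ?R \<le> ell2_norm V (ell2_proj U ?h) + ell2_norm V (ell2_proj (- U) ?k)"
      unfolding split by (intro ell2_add h_in ell2_proj k_in)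
    also have "\<dots> \<le> 1 / d * ell2_norm V y
        + 1 / d * (2 * ((1 + K * g_bound * ell2_norm V f) * ell2_norm V y))"
      using h_bound k_bound ell2_proj(2)[OF k_in, of "- U"] by linarith
    also have "\<dots> = ?C * ell2_norm V y"
      using \<open>0 < d\<close> by (simp add: field_simps)
    finally show "ell2_norm V ?R \<le> ?C * ell2_norm V y" .
  qed
  have left_inverse: "explicit_resolvent z (\<lambda>v. op_app T x v - z * x v) = x"
    if x: "x \<in> op_dom T" for x
  proof -
    let ?y = "\<lambda>v. op_app T x v - z * x v"
    have on_U: "?y v / (lam v - z) = x v" if "v \<in> U" for v
    proof -
      have "unit_vec u v = 0"
        using that u_notin by (auto simp: unit_vec_def)
      then have "?y v = (lam v - z) * x v"
        using that unfolding app_T[OF x] by (simp add: ell2_proj_def f_zero algebra_simps)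
      then show ?thesis
        using nonzero[OF that] by simp
    qed
    have g_y: "g_form (\<lambda>v. ?y v / (lam v - z)) = g_form x"
      by (rule infsum_cong) (simp only: on_U)
    have r: "remainder z ?y v = c_form x * ?e v - z * x v" if "v \<notin> U" for v
      using that unfolding remainder_def g_y unfolding app_T[OF x] by (simp add: ell2_proj_def)
    have "c_form (remainder z ?y) = c_form (\<lambda>v. c_form x * ?e v - z * x v)"
      using r by (rule c_form_cong)
    also have "\<dots> = c_form x * (c_form ?e - z)"
      unfolding c_form_linear by (simp add: algebra_simps)
    finally have s: "resolvent_coeff z ?y = c_form x"
      using gap_nonzero by (simp add: resolvent_coeff_def)
    show ?thesis
      using on_U r s \<open>z \<noteq> 0\<close> by (auto simp: explicit_resolvent_def)
  qed
  have shifted: "(\<lambda>v. op_app T x v - z * x v) \<in> ell2 V" if "x \<in> op_dom T" for x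
    using that by (intro ell2_diff ell2_scale app_T_in_ell2) (auto simp: dom_T)
  have "0 \<le> ?C"
    using \<open>0 < d\<close> \<open>0 \<le> K\<close> g_bound_nonneg by simp
  show "z \<in> resolvent_set V T" "ell2_opnorm V (resolvent T z) \<le> ?C"
    by (rule resolvent_setI[OF R(1,2) shifted left_inverse \<open>0 \<le> ?C\<close> R(3)]; assumption)+
qed

text \<open>All constants needed for the resolvent estimate are uniform in \<open>z\<close> outside the sector of angle
  \<open>\<theta>'\<close> at \<open>a\<close>, except \<open>d = \<kappa> * \<bar>z - a\<bar>\<close>, which yields the required decay.  The angle must really
  grow: near the boundary rays of the given sector the distance from \<open>z\<close> to the \<open>\<lambda>\<^sub>v\<close> may stay
  bounded while \<open>\<bar>z - a\<bar>\<close> tends to infinity.\<close>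

theorem sectorial_if_diagonal_in_sector:
  assumes \<theta>: "0 < \<theta>" "\<theta> < pi / 2" and sector: "lam ` U \<subseteq> sector \<theta> \<alpha>"
  shows "sectorial V T"
proof -
  define \<theta>' where "\<theta>' = (\<theta> + pi / 2) / 2"
  have \<theta>': "\<theta> < \<theta>'" "\<theta>' < pi / 2" "0 < \<theta>'"
    using \<theta> by (simp_all add: \<theta>'_def)
  define \<kappa> where "\<kappa> = (cos \<theta> - cos \<theta>') / 2"
  have cos: "0 < cos \<theta>'" "cos \<theta>' < cos \<theta>" "cos \<theta> \<le> 1" "0 < cos \<theta>"
    using \<theta> \<theta>' cos_gt_zero[of \<theta>'] cos_gt_zero[of \<theta>] cos_monotone_0_pi[of \<theta> \<theta>'] by simp_all
  then have "0 < \<kappa>"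
    by (simp add: \<kappa>_def)
  \<comment> \<open>The first entry gives \<open>\<bar>\<lambda>\<^sub>v - a\<bar> \<ge> 1\<close>, the second one \<open>\<bar>z\<bar> \<ge> \<kappa> * \<bar>a\<bar> \<ge> 2 * c_bound\<close>.\<close>
  define a where "a = min (\<alpha> - 1) (- (2 * c_bound + 1) / \<kappa>)"
  have a: "a \<le> \<alpha> - 1" "2 * c_bound + 1 \<le> \<kappa> * \<bar>a\<bar>" "a < 0"
  proof -
    show "a \<le> \<alpha> - 1"
      by (simp add: a_def)
    have le: "a \<le> - (2 * c_bound + 1) / \<kappa>"
      by (simp add: a_def)
    have "- (2 * c_bound + 1) / \<kappa> < 0"
      using \<open>0 < \<kappa>\<close> c_bound_nonneg by (intro divide_neg_pos) auto
    with le show "a < 0"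
      by linarith
    then show "2 * c_bound + 1 \<le> \<kappa> * \<bar>a\<bar>"
      using le \<open>0 < \<kappa>\<close> by (simp add: field_simps)
  qed
  have cone: "cos \<theta> * cmod (lam v - of_real a) \<le> Re (lam v - of_real a)"
    and far: "1 \<le> cmod (lam v - of_real a)" if "v \<in> U" for v
  proof -
    have "\<bar>Arg (lam v - of_real \<alpha>)\<bar> \<le> \<theta>"
      using sector that by (auto simp: sector_def)
    then have *: "cos \<theta> * cmod (lam v - of_real \<alpha>) \<le> Re (lam v - of_real \<alpha>)"
      using \<theta> by (intro cone_if_abs_Arg_le) auto
    have "cmod (lam v - of_real a) \<le> cmod (lam v - of_real \<alpha>) + (\<alpha> - a)"
      using norm_triangle_ineq[of "lam v - of_real \<alpha>" "of_real (\<alpha> - a)"] a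
      by (simp del: of_real_diff) simp
    then have "cos \<theta> * cmod (lam v - of_real a)
        \<le> cos \<theta> * cmod (lam v - of_real \<alpha>) + cos \<theta> * (\<alpha> - a)"
      using cos by (simp flip: distrib_left)
    also have "\<dots> \<le> Re (lam v - of_real \<alpha>) + 1 * (\<alpha> - a)"
      using * cos a by (intro add_mono mult_right_mono) auto
    finally show "cos \<theta> * cmod (lam v - of_real a) \<le> Re (lam v - of_real a)"
      by simp
    have "0 \<le> cos \<theta> * cmod (lam v - of_real \<alpha>)"
      using cos by simp
    then have "1 \<le> Re (lam v - of_real a)"
      using * a by simp
    then show "1 \<le> cmod (lam v - of_real a)"
      using complex_Re_le_cmod[of "lam v - of_real a"] by linarith
  qed
  have weight: "graph_weight lam v \<le> (2 + \<bar>a\<bar>) * cmod (lam v - of_real a)" if "v \<in> U" for v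
  proof -
    have "cmod (lam v) \<le> cmod (lam v - of_real a) + \<bar>a\<bar> * 1"
      using norm_triangle_ineq[of "lam v - of_real a" "of_real a"] by simp
    also have "\<dots> \<le> cmod (lam v - of_real a) + \<bar>a\<bar> * cmod (lam v - of_real a)"
      using far[OF that] by (intro add_left_mono mult_left_mono) auto
    finally show ?thesis
      using graph_weight_le[of lam v] far[OF that] by (simp add: algebra_simps)
  qed
  define M where "M = (1 + 2 * (1 + (2 + \<bar>a\<bar>) / \<kappa> * g_bound * ell2_norm V f)) / \<kappa>"
  have "0 < M"
    unfolding M_def using \<open>0 < \<kappa>\<close> g_bound_nonneg
    by (intro divide_pos_pos add_pos_nonneg) auto
  have "z \<in> resolvent_set V T \<and> ell2_opnorm V (resolvent T z) \<le> M / cmod (z - of_real a)"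
    if z: "\<theta>' \<le> \<bar>Arg (z - of_real a)\<bar>" for z
  proof -
    let ?\<zeta> = "z - of_real a"
    have "?\<zeta> \<noteq> 0"
      using z \<theta>' by (auto simp: Arg_zero)
    have \<zeta>: "Re ?\<zeta> \<le> cos \<theta>' * cmod ?\<zeta>"
      using z \<theta>' by (intro complement_of_cone_if_abs_Arg_ge) auto
    have sep: "\<kappa> * cmod ?\<zeta> \<le> cmod (w - ?\<zeta>)" "\<kappa> * cmod w \<le> cmod (w - ?\<zeta>)"
      if "cos \<theta> * cmod w \<le> Re w" for w
      unfolding \<kappa>_def using cone_separation[of "cos \<theta>'" "cos \<theta>" w ?\<zeta>] cos that \<zeta> by auto
    \<comment> \<open>The point \<open>0\<close> has coordinate \<open>- a > 0\<close> relative to \<open>a\<close>, so it lies in the inner cone and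
      \<open>z\<close> is separated from it.\<close>
    have "cos \<theta> * cmod (- of_real a) \<le> Re (- of_real a)"
      using a cos mult_right_mono[of "cos \<theta>" 1 "- a"] by simp
    from sep[OF this] have zero: "\<kappa> * cmod ?\<zeta> \<le> cmod z" "\<kappa> * \<bar>a\<bar> \<le> cmod z"
      by simp_all
    have dist: "\<kappa> * cmod ?\<zeta> \<le> cmod (lam v - z)" if "v \<in> U" for v
      using sep(1)[OF cone[OF that]] by simp
    have weight': "graph_weight lam v \<le> (2 + \<bar>a\<bar>) / \<kappa> * cmod (lam v - z)" if "v \<in> U" for v
    proof -
      have "\<kappa> * cmod (lam v - of_real a) \<le> cmod (lam v - z)"
        using sep(2)[OF cone[OF that]] by simp
      then have "cmod (lam v - of_real a) \<le> cmod (lam v - z) / \<kappa>"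
        using \<open>0 < \<kappa>\<close> by (simp add: field_simps)
      from mult_left_mono[OF this, of "2 + \<bar>a\<bar>"] show ?thesis
        using weight[OF that] by simp
    qed
    have "0 < \<kappa> * cmod ?\<zeta>"
      using \<open>0 < \<kappa>\<close> \<open>?\<zeta> \<noteq> 0\<close> by simp
    moreover have "0 \<le> (2 + \<bar>a\<bar>) / \<kappa>" "2 * c_bound \<le> cmod z"
      using \<open>0 < \<kappa>\<close> a zero by auto
    ultimately show ?thesis
      using resolvent_estimate[of "\<kappa> * cmod ?\<zeta>" z "(2 + \<bar>a\<bar>) / \<kappa>"] dist weight' zero(1)
      by (simp add: M_def)
  qed
  then show ?thesis
    unfolding sectorial_def using linear_T dense_T \<open>0 < M\<close> \<theta>'
    by (intro conjI exI[of _ a] exI[of _ M] exI[of _ \<theta>']) simp_all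
qed

end


section \<open>Rank one extensions on trees\<close>

lemma join_U_subset:
  assumes "directed_tree V E" "u \<in> V"
  shows "join_U V E u b \<subseteq> V"
proof -
  have edges: "E \<subseteq> V \<times> V"
    using assms by (simp add: directed_tree_def)
  have "Des E u \<subseteq> V"
  proof
    fix v assume "v \<in> Des E u"
    then have "(u, v) \<in> E\<^sup>*"
      by (simp add: Des_def)
    then show "v \<in> V"
      using edges \<open>u \<in> V\<close> by (cases rule: rtranclE) auto
  qed
  moreover have "Asc E u \<subseteq> V"
  proof
    fix w assume "w \<in> Asc E u"
    then obtain n where "1 \<le> n" "(w, u) \<in> E ^^ n"
      by (auto simp: Asc_def)
    then have "(w, u) \<in> E\<^sup>+"
      by (auto simp: trancl_power intro!: exI[of _ n])
    then show "w \<in> V"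
      using edges by (auto dest: tranclD)
  qed
  ultimately show ?thesis
    by (auto simp: join_U_def)
qed

lemma join_U_not_self:
  assumes "directed_tree V E"
  shows "u \<notin> join_U V E u b"
proof -
  have "u \<notin> Asc E u"
  proof
    assume "u \<in> Asc E u"
    then obtain n where "1 \<le> n" "(u, u) \<in> E ^^ n"
      by (auto simp: Asc_def)
    then have "(u, u) \<in> E\<^sup>+"
      by (auto simp: trancl_power intro!: exI[of _ n])
    then show False
      using assms by (simp add: directed_tree_def acyclic_def)
  qed
  then show ?thesis
    by (auto simp: join_U_def Des_def tree_path_def)
qed

lemma ell2_inner_weight_vec:
  assumes "finite A" and outside: "\<And>v. v \<notin> V \<Longrightarrow> k v = 0"
  shows "ell2_inner V k (weight_vec lam A) = (\<Sum>v\<in>A. lam v * k v)"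
proof -
  have vec: "weight_vec lam A v = (if v \<in> A then cnj (lam v) else 0)" for v
    using \<open>finite A\<close> by (simp add: weight_vec_def unit_vec_def if_distrib cong: if_cong)
  have "ell2_inner V k (weight_vec lam A) = (\<Sum>\<^sub>\<infinity>v\<in>A. lam v * k v)"
    unfolding ell2_inner_def by (rule infsum_cong_neutral) (auto simp: vec outside)
  then show ?thesis
    using \<open>finite A\<close> by simp
qed

text \<open>The tree enters through \<open>U \<subseteq> V\<close> and through \<open>u \<notin> U\<close>, which keeps the range of \<open>N\<close> in the
  orthogonal complement of \<open>\<ell>\<^sup>2(U)\<close>: by acyclicity, \<open>u\<close> is not an ascendant of itself.  The empty \<open>B\<close> in the
  infinite case matches the convention that an infinite sum defining \<open>weight_vec\<close> is 0.\<close>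

lemma rank_one_ext_triangular:
  assumes tree: "directed_tree V E" and "u \<in> V"
    and f: "f \<in> ell2_compl V (ell2 (join_U V E u b))"
    and compat: "compatibility_II (join_U V E u b) lam g"
  defines "U \<equiv> join_U V E u b"
  defines "B \<equiv> (if finite (join_A E u b) then join_A E u b - U else {})"
  shows "triangular_rank_one V U B u lam lam f g (rank_one_ext V E u b lam f g)"
proof -
  let ?W = "rank_one_ext V E u b lam f g"
  have U: "U \<subseteq> V"
    unfolding U_def by (rule join_U_subset[OF tree \<open>u \<in> V\<close>])
  note in_U = ell2_subset_iff[OF U] and compl = ell2_compl_eq[OF U]
  have f': "f \<in> ell2 V" "\<And>v. v \<in> U \<Longrightarrow> f v = 0"
    using f by (simp_all add: compl flip: U_def)
  have dom: "op_dom ?W = {x \<in> ell2 V. ell2_proj U (\<lambda>v. lam v * x v) \<in> ell2 V}"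
  proof (intro set_eqI iffI)
    fix x assume "x \<in> op_dom ?W"
    then obtain h k where x: "x = (\<lambda>v. h v + k v)"
      and h: "h \<in> ell2 U" "(\<lambda>v. lam v * h v) \<in> ell2 U" and k: "k \<in> ell2 V" "\<And>v. v \<in> U \<Longrightarrow> k v = 0"
      by (auto simp: rank_one_ext_def block_op_def diag_op_def join_N_def tensor_op_def compl
          simp flip: U_def)
    have "ell2_proj U (\<lambda>v. lam v * x v) = (\<lambda>v. lam v * h v)"
      using k(2) h(1) by (auto simp: ell2_proj_def x in_U)
    moreover have "x \<in> ell2 V"
      unfolding x using h(1) k(1) by (intro ell2_add) (simp_all add: in_U)
    ultimately show "x \<in> {x \<in> ell2 V. ell2_proj U (\<lambda>v. lam v * x v) \<in> ell2 V}"
      using h(2) by (simp add: in_U)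
  next
    fix x assume "x \<in> {x \<in> ell2 V. ell2_proj U (\<lambda>v. lam v * x v) \<in> ell2 V}"
    then have x: "x \<in> ell2 V" "ell2_proj U (\<lambda>v. lam v * x v) \<in> ell2 V"
      by simp_all
    have "(\<lambda>v. x v * cnj (g v)) summable_on U"
      using summable_on_diagonal_domain[OF _ U x] compat by (simp flip: U_def)
    then have "(\<lambda>v. ell2_proj U x v * cnj (g v)) summable_on U"
      by (rule summable_on_cong[THEN iffD1, rotated]) (simp add: ell2_proj_def)
    moreover have "ell2_proj U (\<lambda>v. lam v * x v) = (\<lambda>v. lam v * ell2_proj U x v)"
      by (auto simp: ell2_proj_def)
    ultimately have h: "ell2_proj U x \<in> op_dom (diag_op U lam) \<inter> op_dom (oslash_op U f g)"
      using x ell2_proj(1)[OF x(1), of U]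
      by (simp add: diag_op_def oslash_op_def in_U) (simp add: ell2_proj_def)
    have k: "ell2_proj (- U) x \<in> op_dom (join_N V E u b lam)"
      using ell2_proj(1)[OF x(1), of "- U"]
      by (simp add: join_N_def tensor_op_def compl flip: U_def) (simp add: ell2_proj_def)
    have "x = (\<lambda>v. ell2_proj U x v + ell2_proj (- U) x v)"
      by (auto simp: ell2_proj_def)
    then show "x \<in> op_dom ?W"
      using h k by (auto simp: rank_one_ext_def block_op_def simp flip: U_def)
  qed
  have app: "op_app ?W x = (\<lambda>v. ell2_proj U (\<lambda>v. lam v * x v) v
      + ((\<Sum>\<^sub>\<infinity>v\<in>U. x v * cnj (g v)) * f v + (\<Sum>v\<in>B. lam v * x v) * unit_vec u v))"
    if "x \<in> op_dom ?W" for x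
  proof -
    let ?A = "join_A E u b" and ?k = "\<lambda>v. x v - ell2_proj U x v"
    have x: "x \<in> ell2 V"
      using that by (simp add: dom)
    have "ell2_inner V ?k (weight_vec lam ?A) = (\<Sum>v\<in>B. lam v * x v)"
    proof (cases "finite ?A")
      case True
      have "?k v = 0" if "v \<notin> V" for v
        using that ell2_outside[OF x] by (simp add: ell2_proj_def)
      then have "ell2_inner V ?k (weight_vec lam ?A) = (\<Sum>v\<in>?A. lam v * ?k v)"
        by (rule ell2_inner_weight_vec[OF True])
      also have "\<dots> = (\<Sum>v\<in>B. lam v * x v)"
        using True by (intro sum.mono_neutral_cong_right) (auto simp: B_def ell2_proj_def)
      finally show ?thesis .
    next
      case False
      then show ?thesis
        by (simp add: B_def weight_vec_def ell2_inner_def)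
    qed
    moreover have "(\<Sum>\<^sub>\<infinity>v\<in>U. ell2_proj U x v * cnj (g v)) = (\<Sum>\<^sub>\<infinity>v\<in>U. x v * cnj (g v))"
      by (rule infsum_cong) (simp add: ell2_proj_def)
    moreover have "lam v * ell2_proj U x v = ell2_proj U (\<lambda>v. lam v * x v) v" for v
      by (simp add: ell2_proj_def)
    ultimately show ?thesis
      by (simp add: rank_one_ext_def block_op_def diag_op_def oslash_op_def join_N_def
          tensor_op_def Let_def flip: U_def)
  qed
  show ?thesis
  proof
    show "u \<notin> U"
      unfolding U_def by (rule join_U_not_self[OF tree])
    show "compatibility_II U lam g"
      unfolding U_def by (rule compat)
  qed (use U \<open>u \<in> V\<close> f' dom app in \<open>auto simp: B_def\<close>)
qed

theorem proposition5p1: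
  fixes V :: "'v set" and E :: "('v \<times> 'v) set" and u b :: 'v
    and lam f g :: "'v \<Rightarrow> complex" and \<theta> \<alpha> :: real
  assumes "rooted_directed_tree V E"
    and "infinite V" and "countable V"
    and "u \<in> V" and "b \<in> V"
    and "f \<in> ell2_compl V (ell2 (join_U V E u b))" and "f \<noteq> (\<lambda>_. 0)"
    and "compatibility_II (join_U V E u b) lam g"
    and "0 < \<theta>" and "\<theta> < pi / 2"
    and "lam ` join_U V E u b \<subseteq> sector \<theta> \<alpha>"
  shows "sectorial V (rank_one_ext V E u b lam f g)"
proof -
  have "directed_tree V E"
    using assms(1) by (simp add: rooted_directed_tree_def)
  from rank_one_ext_triangular[OF this assms(4,6,8)] assms(9-11) show ?thesis
    by (rule triangular_rank_one.sectorial_if_diagonal_in_sector)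
qed

end
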